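(* Let $A=\{0,1,a\}\subset\mathbb{R}$ be a set with $3$ elements (so $a\in\mathbb{R}$, $a\neq 0,1$). Then $A$ is spectral if and only if $a$ is rational and, if $a=p/q$ in its reduced form, then $p+q$ is divisible by $3$.
   Context: For $\lambda\in\mathbb{R}$ let $e_\lambda(x)=e^{2\pi i\lambda x}$, $x\in\mathbb{R}$. A Borel probability measure $\mu$ on $\mathbb{R}$ is spectral if there is a set $\Lambda\subset\mathbb{R}$ (a spectrum of $\mu$) such that $\{e_\lambda:\lambda\in\Lambda\}$ (indexed by $\Lambda$) is an orthonormal basis for $L^2(\mu)$. A finite subset $A$ of $\mathbb{R}$ is called spectral if the measure $\frac{1}{|A|}\sum_{x\in A}\delta_x$ is spectral, where $\delta_x$ is the Dirac measure at $x$. Reduced form $a=p/q$ means $p,q\in\mathbb{Z}$ relatively prime, $q\ne0$. *)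

theory Defs
  imports "HOL-Probability.Probability"
begin

text \<open>Members of \<open>L\<^sup>2(M)\<close> are represented by functions, not by classes modulo equality
  almost everywhere; the notions below depend only on the classes.\<close>

definition square_integrable :: "'a measure \<Rightarrow> ('a \<Rightarrow> complex) set" where
  "square_integrable M =
     {f \<in> borel_measurable M. integrable M (\<lambda>x. (cmod (f x))\<^sup>2)}"

definition inner_L2 :: "'a measure \<Rightarrow> ('a \<Rightarrow> complex) \<Rightarrow> ('a \<Rightarrow> complex) \<Rightarrow> complex" where
  "inner_L2 M f g = (LINT x|M. f x * cnj (g x))"

definition norm_L2 :: "'a measure \<Rightarrow> ('a \<Rightarrow> complex) \<Rightarrow> real" where
  "norm_L2 M f = sqrt (LINT x|M. (cmod (f x))\<^sup>2)"

definition orthonormal_family :: "'a measure \<Rightarrow> ('i \<Rightarrow> 'a \<Rightarrow> complex) \<Rightarrow> 'i set \<Rightarrow> bool" where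
  "orthonormal_family M e I \<longleftrightarrow>
     (\<forall>i\<in>I. e i \<in> square_integrable M) \<and>
     (\<forall>i\<in>I. \<forall>j\<in>I. inner_L2 M (e i) (e j) = (if i = j then 1 else 0))"

definition orthonormal_basis_L2 :: "'a measure \<Rightarrow> ('i \<Rightarrow> 'a \<Rightarrow> complex) \<Rightarrow> 'i set \<Rightarrow> bool" where
  \<comment> \<open>The second conjunct says that the linear span of the family is dense in \<open>L\<^sup>2(M)\<close>.\<close>
  "orthonormal_basis_L2 M e I \<longleftrightarrow>
     orthonormal_family M e I \<and>
     (\<forall>f \<in> square_integrable M. \<forall>\<epsilon>>0. \<exists>J c. finite J \<and> J \<subseteq> I \<and>
        norm_L2 M (\<lambda>x. f x - (\<Sum>i\<in>J. c i * e i x)) < \<epsilon>)"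

definition expo :: "real \<Rightarrow> real \<Rightarrow> complex" where
  "expo l x = exp (2 * of_real pi * \<i> * of_real l * of_real x)"

definition spectrum_of :: "real measure \<Rightarrow> real set \<Rightarrow> bool" where
  "spectrum_of \<mu> L \<longleftrightarrow> orthonormal_basis_L2 \<mu> expo L"

definition spectral_measure :: "real measure \<Rightarrow> bool" where
  "spectral_measure \<mu> \<longleftrightarrow>
     sets \<mu> = sets borel \<and> prob_space \<mu> \<and> (\<exists>L. spectrum_of \<mu> L)"

definition uniform_dirac :: "real set \<Rightarrow> real measure" where
  "uniform_dirac A = measure_of UNIV (sets borel)
     (\<lambda>B. (\<Sum>x\<in>A. emeasure (return borel x) B) / of_nat (card A))"

text \<open>\<open>measure_of\<close> would silently yield the zero measure if its argument were not countably
  additive; this rules that out.\<close>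

lemma sets_uniform_dirac [simp, measurable_cong]: "sets (uniform_dirac A) = sets borel"
  unfolding uniform_dirac_def
  by (metis sets.sigma_sets_eq sets_measure_of space_borel subset_UNIV Pow_UNIV)

lemma space_uniform_dirac [simp]: "space (uniform_dirac A) = UNIV"
  using sets_eq_imp_space_eq[OF sets_uniform_dirac[of A]] by simp

lemma emeasure_uniform_dirac:
  assumes "B \<in> sets borel"
  shows "emeasure (uniform_dirac A) B
    = (\<Sum>x\<in>A. emeasure (return borel x) B) / of_nat (card A)"
proof (rule emeasure_measure_of[OF uniform_dirac_def])
  show "countably_additive (sets (uniform_dirac A))
     (\<lambda>B. (\<Sum>x\<in>A. emeasure (return borel x) B) / of_nat (card A))"
    unfolding countably_additive_def
  proof safe
    fix F :: "nat \<Rightarrow> real set"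
    assume F: "range F \<subseteq> sets (uniform_dirac A)" "disjoint_family F"
    have 1: "(\<Sum>i. emeasure (return borel x) (F i)) = emeasure (return borel x) (\<Union>(range F))"
      for x :: real
      using F by (intro suminf_emeasure) auto
    have "(\<Sum>i. (\<Sum>x\<in>A. emeasure (return borel x) (F i)) / of_nat (card A))
        = (\<Sum>i. \<Sum>x\<in>A. emeasure (return borel x) (F i)) / of_nat (card A)"
      by (simp add: divide_ennreal_def)
    also have "(\<Sum>i. \<Sum>x\<in>A. emeasure (return borel x) (F i))
        = (\<Sum>x\<in>A. \<Sum>i. emeasure (return borel x) (F i))"
      by (rule suminf_sum) simp
    finally show "(\<Sum>i. (\<Sum>x\<in>A. emeasure (return borel x) (F i)) / of_nat (card A))
        = (\<Sum>x\<in>A. emeasure (return borel x) (\<Union>(range F))) / of_nat (card A)"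
      by (simp add: 1)
  qed
qed (use assms in \<open>auto simp: positive_def\<close>)

lemma prob_space_uniform_dirac:
  assumes "finite A" "A \<noteq> {}"
  shows "prob_space (uniform_dirac A)"
proof
  have "(\<Sum>x\<in>A. emeasure (return borel x) (UNIV :: real set)) = of_nat (card A)"
    by simp
  then show "emeasure (uniform_dirac A) (space (uniform_dirac A)) = 1"
    using assms
    by (simp add: emeasure_uniform_dirac)
      (auto intro!: ennreal_divide_self simp: top.not_eq_extremum of_nat_less_top)
qed

definition spectral_set :: "real set \<Rightarrow> bool" where
  "spectral_set A \<longleftrightarrow> finite A \<and> spectral_measure (uniform_dirac A)"

end

theory Submission imports Defs begin

text \<open>
  Integration against the uniform measure on \<open>A\<close> is averaging over \<open>A\<close>, so \<open>l\<close> and \<open>l'\<close> give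
  orthogonal exponentials on \<open>{0, 1, a}\<close> exactly when \<open>1 + z + w = 0\<close>, where \<open>z\<close> and \<open>w\<close> are the
  values at \<open>1\<close> and at \<open>a\<close> of the exponential with frequency \<open>d = l - l'\<close>.  Three unit complex
  numbers sum to zero only if they are the vertices of an equilateral triangle
  (\<open>unit_triple_sum_zero_iff\<close>), so this means \<open>3 d \<in> \<int>\<close>, \<open>d \<notin> \<int>\<close> and \<open>d + d a \<in> \<int>\<close>
  (\<open>expo_sum_zero_iff\<close>).

  If the set is spectral, the spectrum has at least two points, because \<open>L\<^sup>2\<close> is not
  one-dimensional (\<open>spectrum_has_two_points\<close>).  A single nonzero difference \<open>d\<close> then determines
  \<open>a\<close>: with \<open>m = 3 d\<close> and \<open>n = 3 d a\<close> one gets \<open>a = n / m\<close> with integers \<open>m\<close>, \<open>n\<close> such that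
  \<open>3\<close> divides \<open>m + n\<close> but not \<open>m\<close>, and this passes to the reduced fraction
  (\<open>three_dvd_reduced_fraction\<close>).

  If conversely \<open>a = p / q\<close> is reduced and \<open>3\<close> divides \<open>p + q\<close>, then \<open>3\<close> divides none of \<open>p\<close>, \<open>q\<close>,
  \<open>p - q\<close>.  Hence \<open>0, q, p\<close> are distinct modulo \<open>3\<close>, and the values of the exponentials with
  frequencies \<open>{0, q/3, 2 q/3}\<close> on \<open>{0, 1, a}\<close> form the character table of the cyclic group of order \<open>3\<close>, up to the
  order of its columns.  Rows and columns of this table are both orthogonal; the rows give
  orthonormality and the columns give completeness (\<open>spectrum_ofI\<close>).
\<close>

section \<open>The space of square integrable functions on a finite set\<close>

lemma uniform_dirac_eq_distr:
  assumes "finite A" "A \<noteq> {}"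
  shows "uniform_dirac A = distr (uniform_count_measure A) borel (\<lambda>x. x)"
proof (rule measure_eqI)
  fix B assume "B \<in> sets (uniform_dirac A)"
  then have B: "B \<in> sets borel" by simp
  have id: "(\<lambda>x. x) \<in> measurable (uniform_count_measure A) borel"
    by (simp add: measurable_def space_uniform_count_measure sets_uniform_count_measure)
  have "(\<Sum>x\<in>A. emeasure (return borel x) B) = (\<Sum>x\<in>A. indicator B x :: ennreal)"
    using B by simp
  also have "\<dots> = of_nat (card (B \<inter> A))"
    using assms by (simp add: indicator_def sum.If_cases Int_def conj_commute)
  also have "\<dots> / of_nat (card A) = ennreal (card (B \<inter> A) / card A)"
    using assms by (simp add: divide_ennreal card_gt_0_iff ennreal_of_nat_eq_real_of_nat)
  finally show "emeasure (uniform_dirac A) B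
      = emeasure (distr (uniform_count_measure A) borel (\<lambda>x. x)) B"
    using assms B id
    by (simp add: emeasure_uniform_dirac emeasure_distr emeasure_uniform_count_measure
        space_uniform_count_measure)
qed simp

lemma
  fixes f :: "real \<Rightarrow> 'b :: {banach, second_countable_topology}"
  assumes "finite A" "A \<noteq> {}" and f: "f \<in> borel_measurable borel"
  shows integrable_uniform_dirac: "integrable (uniform_dirac A) f"
    and integral_uniform_dirac: "(LINT x|uniform_dirac A. f x) = (\<Sum>x\<in>A. f x) /\<^sub>R card A"
proof -
  have id: "(\<lambda>x. x) \<in> measurable (uniform_count_measure A) borel"
    by (simp add: measurable_def space_uniform_count_measure sets_uniform_count_measure)
  show "integrable (uniform_dirac A) f"
    using assms
    by (simp add: uniform_dirac_eq_distr integrable_distr_eq[OF id f])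
      (simp add: uniform_count_measure_def integrable_point_measure_finite)
  show "(LINT x|uniform_dirac A. f x) = (\<Sum>x\<in>A. f x) /\<^sub>R card A"
    using assms
    by (simp add: uniform_dirac_eq_distr integral_distr[OF id f])
      (simp add: uniform_count_measure_def lebesgue_integral_point_measure_finite
        scaleR_right.sum divide_inverse)
qed

lemma square_integrable_uniform_dirac:
  assumes "finite A" "A \<noteq> {}"
  shows "square_integrable (uniform_dirac A) = borel_measurable borel"
proof -
  have "f \<in> borel_measurable (uniform_dirac A) \<longleftrightarrow> f \<in> borel_measurable borel" for f :: "real \<Rightarrow> complex"
    by (simp add: measurable_cong_sets[OF sets_uniform_dirac refl])
  then show ?thesis
    using assms by (auto simp: square_integrable_def intro!: integrable_uniform_dirac)
qed

lemma norm_L2_uniform_dirac: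
  assumes "finite A" "A \<noteq> {}" "f \<in> borel_measurable borel"
  shows "norm_L2 (uniform_dirac A) f = sqrt ((\<Sum>x\<in>A. (cmod (f x))\<^sup>2) / card A)"
  using assms by (simp add: norm_L2_def integral_uniform_dirac divide_inverse_commute)

section \<open>Exponentials\<close>

lemma expo_measurable [measurable]: "expo l \<in> borel_measurable borel"
  unfolding expo_def by measurable

lemma expo_conv_cis: "expo l x = cis (2 * pi * (l * x))"
  by (simp add: expo_def cis_conv_exp mult_ac)

lemma norm_expo [simp]: "cmod (expo l x) = 1"
  by (simp add: expo_conv_cis)

lemma expo_zero_left [simp]: "expo 0 x = 1"
  and expo_zero_right [simp]: "expo l 0 = 1"
  by (simp_all add: expo_def)

lemma expo_mult_cnj_freq: "expo l x * cnj (expo l' x) = expo (l - l') x"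
  by (simp add: expo_conv_cis cis_cnj cis_mult algebra_simps)

lemma expo_mult_cnj_point: "expo l x * cnj (expo l y) = expo l (x - y)"
  by (simp add: expo_conv_cis cis_cnj cis_mult algebra_simps)

lemma cis_2pi_eq_1_iff: "cis (2 * pi * t) = 1 \<longleftrightarrow> t \<in> \<int>"
proof
  assume "cis (2 * pi * t) = 1"
  then obtain n :: int where "2 * pi * t = of_int (2 * n) * pi"
    unfolding cis_conv_exp exp_eq_1 by auto
  then have "t = of_int n" by simp
  then show "t \<in> \<int>" by simp
qed (rule cis_multiple_2pi)

lemma inner_L2_expo:
  assumes "finite A" "A \<noteq> {}"
  shows "inner_L2 (uniform_dirac A) (expo l) (expo l') = (\<Sum>x\<in>A. expo (l - l') x) / card A"
  unfolding inner_L2_def expo_mult_cnj_freq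
  using assms
  by (simp add: integral_uniform_dirac scaleR_conv_of_real divide_inverse_commute)

text \<open>Conjugation inverts unit complex numbers, so the conjugate of \<open>1 + z + w = 0\<close>, multiplied by
  \<open>z w\<close>, is \<open>z w + w + z = 0\<close>; comparing the two equations yields \<open>z w = 1\<close>.\<close>

lemma unit_triple_sum_zero_iff:
  fixes z w :: complex
  assumes "cmod z = 1" "cmod w = 1"
  shows "1 + z + w = 0 \<longleftrightarrow> z ^ 3 = 1 \<and> z \<noteq> 1 \<and> z * w = 1"
proof
  have zz: "z * cnj z = 1" and ww: "w * cnj w = 1"
    using assms by (simp_all add: complex_norm_square[symmetric])
  assume s: "1 + z + w = 0"
  then have "cnj (1 + z + w) = 0" by (simp only: complex_cnj_zero)
  then have "z * w * (1 + cnj z + cnj w) = 0"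
    by (simp only: complex_cnj_add complex_cnj_one mult_zero_right)
  moreover have "z * w * (1 + cnj z + cnj w) = z * w + (z * cnj z) * w + z * (w * cnj w)"
    by (simp add: algebra_simps)
  ultimately have "z * w + z + w = 0"
    by (simp only: zz ww mult_1 mult_1_right) (simp only: add_ac)
  then have zw: "z * w = 1"
    using s by algebra
  have "z ^ 3 = 1"
    using zw s by algebra
  moreover have "z \<noteq> 1"
  proof
    assume "z = 1"
    with zw s show False by simp
  qed
  ultimately show "z ^ 3 = 1 \<and> z \<noteq> 1 \<and> z * w = 1"
    using zw by simp
next
  assume *: "z ^ 3 = 1 \<and> z \<noteq> 1 \<and> z * w = 1"
  have "z ^ 3 - 1 = (z - 1) * (z\<^sup>2 + z + 1)"
    by (simp add: algebra_simps power2_eq_square power3_eq_cube)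
  with * have sq: "z\<^sup>2 + z + 1 = 0" by simp
  from * have "w = w * z ^ 3" by simp
  also have "\<dots> = (z * w) * z\<^sup>2"
    by (simp add: power2_eq_square power3_eq_cube mult_ac)
  finally have "w = z\<^sup>2" using * by simp
  with sq show "1 + z + w = 0" by (simp add: add_ac)
qed

lemma expo_sum_zero_iff:
  "1 + expo l x + expo l' x' = 0 \<longleftrightarrow> 3 * (l * x) \<in> \<int> \<and> l * x \<notin> \<int> \<and> l * x + l' * x' \<in> \<int>"
proof -
  have "expo l x ^ 3 = cis (2 * pi * (3 * (l * x)))"
    by (simp add: expo_conv_cis Complex.DeMoivre mult_ac)
  moreover have "expo l x * expo l' x' = cis (2 * pi * (l * x + l' * x'))"
    by (simp add: expo_conv_cis cis_mult ring_distribs)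
  ultimately show ?thesis
    by (simp only: unit_triple_sum_zero_iff norm_expo cis_2pi_eq_1_iff)
      (simp only: expo_conv_cis cis_2pi_eq_1_iff)
qed

section \<open>Spectra of finite sets\<close>

text \<open>The indicator of a point \<open>x\<close> stays away from the line spanned by one exponential \<open>e\<close>:
  approximating it at \<open>x\<close> forces \<open>c e\<close> to have modulus close to \<open>1\<close> there, hence also at every
  other point \<open>y\<close>, where the indicator vanishes.\<close>

lemma spectrum_has_two_points:
  assumes A: "finite A" and xy: "x \<in> A" "y \<in> A" "x \<noteq> y"
    and spec: "spectrum_of (uniform_dirac A) L"
  obtains l l' where "l \<in> L" "l' \<in> L" "l \<noteq> l'"
proof (rule ccontr)
  assume "\<not> thesis"
  then have one: "l = l'" if "l \<in> L" "l' \<in> L" for l l'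
    using that \<open>\<And>l l'. \<lbrakk>l \<in> L; l' \<in> L; l \<noteq> l'\<rbrakk> \<Longrightarrow> thesis\<close> by blast
  have A': "A \<noteq> {}" and cA: "real (card A) > 0"
    using A xy by (auto simp: card_gt_0_iff)
  define f :: "real \<Rightarrow> complex" where "f = indicator {x}"
  have fm [measurable]: "f \<in> borel_measurable borel" by (simp add: f_def)
  define \<epsilon> where "\<epsilon> = sqrt (1 / 2 / card A)"
  have "\<epsilon> > 0" using cA by (simp add: \<epsilon>_def)
  then obtain J c where J: "finite J" "J \<subseteq> L"
    and less: "norm_L2 (uniform_dirac A) (\<lambda>x. f x - (\<Sum>i\<in>J. c i * expo i x)) < \<epsilon>"
    using spec fm
    unfolding spectrum_of_def orthonormal_basis_L2_def square_integrable_uniform_dirac[OF A A']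
    by blast
  define g where "g t = (\<Sum>i\<in>J. c i * expo i t)" for t
  \<comment> \<open>\<open>g\<close> is a multiple of at most one exponential, so its modulus is constant.\<close>
  have g: "cmod (g x) = cmod (g y)"
  proof (cases "J = {}")
    case False
    then obtain j where "j \<in> J" by blast
    then have "J = {j}" using J one by blast
    then show ?thesis by (simp add: g_def norm_mult)
  qed (simp add: g_def)
  define s where "s = cmod (g y)"
  have "norm_L2 (uniform_dirac A) (\<lambda>x. f x - (\<Sum>i\<in>J. c i * expo i x))
      = sqrt ((\<Sum>t\<in>A. (cmod (f t - g t))\<^sup>2) / card A)"
    unfolding g_def using A A' by (intro norm_L2_uniform_dirac) auto
  with less have "(\<Sum>t\<in>A. (cmod (f t - g t))\<^sup>2) < 1 / 2"
    using cA by (simp add: \<epsilon>_def divide_less_cancel field_simps)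
  moreover have "(\<Sum>t\<in>{x, y}. (cmod (f t - g t))\<^sup>2) \<le> (\<Sum>t\<in>A. (cmod (f t - g t))\<^sup>2)"
    using A xy by (intro sum_mono2) auto
  moreover have "(\<Sum>t\<in>{x, y}. (cmod (f t - g t))\<^sup>2) = (cmod (1 - g x))\<^sup>2 + s\<^sup>2"
    using xy by (simp add: f_def s_def)
  moreover have "(1 - s)\<^sup>2 \<le> (cmod (1 - g x))\<^sup>2"
    using norm_triangle_ineq3[of 1 "g x"] g by (simp add: abs_le_square_iff[symmetric] s_def)
  moreover have "1 / 2 \<le> (1 - s)\<^sup>2 + s\<^sup>2"
    using zero_le_power2[of "2 * s - 1"] by (simp add: power2_eq_square algebra_simps)
  ultimately show False by linarith
qed

text \<open>The second orthogonality relation says that the Fourier matrix has orthogonal columns, so that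
  every function on \<open>A\<close> equals its Fourier expansion and no limit is involved; for \<open>x = y\<close> it also
  forces \<open>L\<close> and \<open>A\<close> to have the same size.\<close>

lemma spectrum_ofI:
  assumes A: "finite A" "A \<noteq> {}" and L: "finite L"
    and rows: "\<And>l l'. l \<in> L \<Longrightarrow> l' \<in> L \<Longrightarrow> l \<noteq> l' \<Longrightarrow> (\<Sum>x\<in>A. expo (l - l') x) = 0"
    and cols: "\<And>x y. x \<in> A \<Longrightarrow> y \<in> A \<Longrightarrow>
      (\<Sum>l\<in>L. expo l (x - y)) = (if x = y then of_nat (card A) else 0)"
  shows "spectrum_of (uniform_dirac A) L"
  unfolding spectrum_of_def orthonormal_basis_L2_def
proof (intro conjI ballI allI impI)
  have cA: "of_nat (card A) \<noteq> (0 :: complex)" using A by simp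
  show "orthonormal_family (uniform_dirac A) expo L"
    unfolding orthonormal_family_def
    using A rows by (auto simp: inner_L2_expo square_integrable_uniform_dirac)
  fix f and \<epsilon> :: real
  assume "f \<in> square_integrable (uniform_dirac A)" and \<epsilon>: "\<epsilon> > 0"
  then have f [measurable]: "f \<in> borel_measurable borel"
    using A by (simp add: square_integrable_uniform_dirac)
  define c where "c l = (\<Sum>y\<in>A. f y * cnj (expo l y)) / card A" for l
  have expansion: "(\<Sum>l\<in>L. c l * expo l x) = f x" if x: "x \<in> A" for x
  proof -
    have "(\<Sum>l\<in>L. c l * expo l x)
        = (\<Sum>l\<in>L. \<Sum>y\<in>A. f y * (expo l x * cnj (expo l y)) / card A)"
      by (simp add: c_def sum_distrib_left sum_divide_distrib mult_ac)
    also have "\<dots> = (\<Sum>y\<in>A. \<Sum>l\<in>L. f y * (expo l x * cnj (expo l y)) / card A)"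
      by (rule sum.swap)
    also have "\<dots> = (\<Sum>y\<in>A. f y * (\<Sum>l\<in>L. expo l (x - y)) / card A)"
      by (simp add: expo_mult_cnj_point sum_distrib_left sum_divide_distrib)
    also have "\<dots> = (\<Sum>y\<in>A. if x = y then f y else 0)"
      using x cA by (intro sum.cong) (auto simp: cols)
    also have "\<dots> = f x" using A x by simp
    finally show ?thesis .
  qed
  have "norm_L2 (uniform_dirac A) (\<lambda>x. f x - (\<Sum>i\<in>L. c i * expo i x))
      = sqrt ((\<Sum>x\<in>A. (cmod (f x - (\<Sum>i\<in>L. c i * expo i x)))\<^sup>2) / card A)"
    using A by (intro norm_L2_uniform_dirac) auto
  also have "\<dots> = 0" using expansion by simp
  finally show "\<exists>J c. finite J \<and> J \<subseteq> L \<and>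
      norm_L2 (uniform_dirac A) (\<lambda>x. f x - (\<Sum>i\<in>J. c i * expo i x)) < \<epsilon>"
    using L \<epsilon> by (intro exI[of _ L] exI[of _ c]) simp
qed

section \<open>Three-point sets\<close>

text \<open>An integer fraction \<open>n / m\<close> arises from the reduced one by a common factor \<open>k\<close>; since \<open>k\<close>
  divides \<open>m\<close>, it is prime to \<open>3\<close> and can be cancelled from \<open>m + n = k (p + q)\<close>.\<close>

lemma three_dvd_reduced_fraction:
  fixes m n p q :: int
  assumes eq: "n * q = p * m" and pq: "coprime p q" "q \<noteq> 0"
    and m: "\<not> 3 dvd m" and mn: "3 dvd m + n"
  shows "3 dvd p + q"
proof -
  have "q dvd p * m" using eq by (metis dvd_triv_right)
  then have "q dvd m" using pq by (simp add: coprime_commute coprime_dvd_mult_right_iff)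
  then obtain k where k: "m = q * k" ..
  with eq pq have n: "n = p * k" by simp
  have "3 dvd k * (p + q)" using mn by (simp add: k n algebra_simps)
  moreover have "\<not> 3 dvd k" using m by (auto simp: k)
  moreover have "prime (3 :: int)" by simp
  ultimately show ?thesis by (simp add: prime_dvd_mult_iff)
qed

lemma third_in_Ints_iff: "of_int k / 3 \<in> (\<int> :: real set) \<longleftrightarrow> 3 dvd k"
proof
  assume "of_int k / 3 \<in> (\<int> :: real set)"
  then obtain j where "of_int k / 3 = (of_int j :: real)" by (elim Ints_cases)
  then have "real_of_int k = of_int (3 * j)" by simp
  then have "k = 3 * j" by (simp only: of_int_eq_iff)
  then show "3 dvd k" by simp
next
  assume "3 dvd k"
  then show "of_int k / 3 \<in> (\<int> :: real set)" by auto
qed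

lemma spectrum_of_triple_imp_fraction:
  assumes a: "a \<noteq> 0" "a \<noteq> (1 :: real)" and spec: "spectrum_of (uniform_dirac {0, 1, a}) L"
  obtains m n :: int where "a = of_int n / of_int m" "\<not> 3 dvd m" "3 dvd m + n"
proof -
  obtain l l' where l: "l \<in> L" "l' \<in> L" "l \<noteq> l'"
    by (rule spectrum_has_two_points[OF _ _ _ _ spec, of 0 1]) auto
  define d where "d = l - l'"
  have "inner_L2 (uniform_dirac {0, 1, a}) (expo l) (expo l') = 0"
    using spec l
    unfolding spectrum_of_def orthonormal_basis_L2_def orthonormal_family_def by auto
  then have "1 + expo d 1 + expo d a = 0"
    using a by (simp add: inner_L2_expo d_def add.assoc)
  then have d: "3 * d \<in> \<int>" "d \<notin> \<int>" "d + d * a \<in> \<int>"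
    by (simp_all add: expo_sum_zero_iff)
  then obtain m k where m: "3 * d = of_int m" and k: "d + d * a = of_int k"
    by (elim Ints_cases)
  have dm: "d = of_int m / 3" using m by simp
  then have m3: "\<not> 3 dvd m" using d(2) third_in_Ints_iff[of m] by auto
  then have "m \<noteq> 0" by auto
  then have "a = of_int (3 * k - m) / of_int m"
    using k by (simp add: dm field_simps)
  then show thesis using m3 by (rule that) simp
qed

text \<open>After multiplication by \<open>3 / q\<close> the differences of frequencies become \<open>1, 2, -1, -2\<close>, and after
  multiplication by \<open>q\<close> the differences of points become \<open>q\<close>, \<open>p\<close>, \<open>p - q\<close> and their negatives.
  None of these integers is divisible by \<open>3\<close>, so the same vanishing criterion gives both
  orthogonality relations.\<close>

lemma spectrum_of_triple:
  fixes p q :: int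
  assumes pq: "coprime p q" and q0: "q \<noteq> 0" and three: "3 dvd p + q"
    and a: "a = of_int p / of_int q" "a \<noteq> 0" "a \<noteq> 1"
  shows "spectrum_of (uniform_dirac {0, 1, a}) {0, q / 3, 2 * q / 3}"
proof (rule spectrum_ofI)
  have nq: "\<not> 3 dvd q"
  proof
    assume "3 dvd q"
    moreover with three have "3 dvd p" by (simp add: dvd_add_left_iff)
    ultimately have "is_unit (3 :: int)" using pq coprime_common_divisor by blast
    then show False by simp
  qed
  have np: "\<not> 3 dvd p" and npq: "\<not> 3 dvd p - q"
    using nq three by presburger+
  have row: "1 + expo (of_int j * q / 3) 1 + expo (of_int j * q / 3) a = 0" if "\<not> 3 dvd j" for j
  proof -
    have "\<not> 3 dvd j * q" using nq that by (simp add: prime_dvd_mult_iff)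
    then have "real_of_int j * q / 3 \<notin> \<int>"
      using third_in_Ints_iff[of "j * q"] by simp
    moreover have "real_of_int j * q / 3 + real_of_int j * q / 3 * a = of_int (j * (p + q)) / 3"
      using q0 by (simp add: a field_simps)
    then have "real_of_int j * q / 3 + real_of_int j * q / 3 * a \<in> \<int>"
      using three by (simp only: third_in_Ints_iff dvd_mult)
    ultimately show ?thesis
      by (simp add: expo_sum_zero_iff)
  qed
  have col: "1 + expo (q / 3) t + expo (2 * q / 3) t = 0"
    if "q * t = of_int k" "\<not> 3 dvd k" for t :: real and k :: int
  proof -
    have "q / 3 * t = of_int k / 3" "q / 3 * t + 2 * q / 3 * t = of_int k"
      using that by simp_all
    then show ?thesis
      using that third_in_Ints_iff[of k]
      by (simp only: expo_sum_zero_iff) simp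
  qed
  let ?A = "{0, 1, a}" and ?L = "{0, q / 3, 2 * q / 3}"
  show "finite ?A" "?A \<noteq> {}" "finite ?L" by auto
  show "(\<Sum>x\<in>?A. expo (l - l') x) = 0" if "l \<in> ?L" "l' \<in> ?L" "l \<noteq> l'" for l l'
  proof -
    have "l - l' \<in> (\<lambda>j. of_int j * q / 3) ` {1, 2, -1, -2 :: int}"
      using that by auto
    then obtain j :: int where diff: "l - l' = of_int j * q / 3" and j: "j \<in> {1, 2, -1, -2}"
      by (elim imageE)
    have "\<not> 3 dvd j" using j by auto
    then show ?thesis unfolding diff using row[of j] a(2,3) by (simp add: add.assoc)
  qed
  show "(\<Sum>l\<in>?L. expo l (x - y)) = (if x = y then of_nat (card ?A) else 0)"
    if "x \<in> ?A" "y \<in> ?A" for x y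
  proof (cases "x = y")
    case False
    have qa: "q * a = p" using q0 by (simp add: a)
    have "q * (x - y) \<in> of_int ` {q, p, p - q, - q, - p, q - p}"
      using that False qa by (auto simp: algebra_simps)
    then obtain k where "q * (x - y) = of_int k" and k: "k \<in> {q, p, p - q, - q, - p, q - p}"
      by (elim imageE)
    moreover have "\<not> 3 dvd k" using k nq np npq by (auto simp: dvd_diff_commute)
    ultimately show ?thesis using col[of "x - y" k] False q0 by (simp add: add.assoc)
  qed (use a q0 in auto)
qed

theorem corollary3p6:
  fixes a :: real
  assumes "card {0, 1, a} = 3"
  shows "spectral_set {0, 1, a} \<longleftrightarrow>
    a \<in> \<rat> \<and>
    (\<forall>p q :: int. coprime p q \<and> q \<noteq> 0 \<and> a = of_int p / of_int q \<longrightarrow> 3 dvd p + q)"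
proof -
  have a: "a \<noteq> 0" "a \<noteq> 1" using assms by (auto simp: card_insert_if split: if_splits)
  show ?thesis
  proof
    assume "spectral_set {0, 1, a}"
    then obtain L where "spectrum_of (uniform_dirac {0, 1, a}) L"
      unfolding spectral_set_def spectral_measure_def by blast
    with a obtain m n :: int
      where mn: "a = of_int n / of_int m" "\<not> 3 dvd m" "3 dvd m + n"
      by (rule spectrum_of_triple_imp_fraction)
    have "m \<noteq> 0" using mn by auto
    have "3 dvd p + q" if pq: "coprime p q" "q \<noteq> 0" "a = of_int p / of_int q" for p q :: int
    proof -
      have "real_of_int (n * q) = of_int (p * m)"
        using mn(1) pq \<open>m \<noteq> 0\<close> by (simp add: field_simps)
      then have "n * q = p * m" by (simp only: of_int_eq_iff)
      then show ?thesis
        using pq(1,2) mn(2,3) by (rule three_dvd_reduced_fraction)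
    qed
    moreover have "a \<in> \<rat>" by (simp add: mn)
    ultimately show "a \<in> \<rat> \<and>
      (\<forall>p q :: int. coprime p q \<and> q \<noteq> 0 \<and> a = of_int p / of_int q \<longrightarrow> 3 dvd p + q)" by blast
  next
    assume *: "a \<in> \<rat> \<and>
      (\<forall>p q :: int. coprime p q \<and> q \<noteq> 0 \<and> a = of_int p / of_int q \<longrightarrow> 3 dvd p + q)"
    then obtain p q :: int where "q > 0" "coprime p q" "a = of_int p / of_int q"
      by (auto elim: Rats_cases')
    with * a have "spectrum_of (uniform_dirac {0, 1, a}) {0, q / 3, 2 * q / 3}"
      by (intro spectrum_of_triple) auto
    then show "spectral_set {0, 1, a}"
      unfolding spectral_set_def spectral_measure_def
      by (auto intro: prob_space_uniform_dirac)
  qed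
qed

end
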